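(* The distance signless Laplacian spectrum of the firefly-type graph $F_{p,n-p}$ (the multiset of eigenvalues of $D^Q(F_{p,n-p})$, superscripts denoting multiplicities) is $$\left\{(4n-2p-3)^{\,n-1},\ (4n-2p-5)^{\,n-p-1},\ \lambda_1,\lambda_2,\lambda_3\right\},$$ where $\lambda_1,\lambda_2,\lambda_3$ are the roots of $$\begin{aligned}p(x)={}&x^3-(14n-7p-8)x^2+(56n^2+14p^2-62n+27p-56np+15)x\\&-64n^3+8p^3+96n^2+20p^2+96n^2p-48np^2-88np+16p.\end{aligned}$$
   Context: For a connected graph $\Gamma$, the distance matrix is $D(\Gamma)=(d(u,v))_{u,v\in V(\Gamma)}$, where $d$ is the shortest-path distance, and $Tr(\Gamma)$ is the diagonal matrix whose entry at a vertex $v$ is the transmission $\sum_{u\in V(\Gamma)}d(u,v)$. The distance signless Laplacian matrix is $D^Q(\Gamma)=Tr(\Gamma)+D(\Gamma)$. The friendship graph $F_n=K_1\vee(nK_2)$ is a single vertex joined to all vertices of $n$ disjoint copies of $K_2$. The firefly-type graph $F_{p,n-p}$ is obtained from $F_n$ by replacing $p$ ($\ge 1$) of its copies of $K_2$ with $K_1$; that is, $F_{p,n-p}=K_1\vee\left(pK_1\cup(n-p)K_2\right)$, a single vertex joined to all vertices of the disjoint union of $p$ copies of $K_1$ and $n-p$ copies of $K_2$.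
   Formalization: The constant term of p(x) is corrected by adding the missing summand -36n (as printed it is false, e.g. for n=2, p=1); for p=n, the exponent n-p-1=-1 is read as removing one copy of 4n-2p-5 from the listed multiset. *)

theory Defs
  imports
    Complex_Main
    "HOL-Library.Multiset"
    "HOL-Computational_Algebra.Polynomial"
    "HOL-Computational_Algebra.Fundamental_Theorem_Algebra"
    "Graph_Theory.Pair_Digraph"
    "Graph_Theory.Digraph_Component"
    "Graph_Theory.Shortest_Path"
    "Jordan_Normal_Form.Char_Poly"
begin

text \<open>
  As in the Graph_Theory library, a finite simple graph is a symmetric loopfree digraph with
  finitely many vertices (\<^locale>\<open>pair_graph\<close>).
\<close>

definition complete_graph :: "nat \<Rightarrow> nat pair_pre_digraph" where
  "complete_graph m = \<lparr> pverts = {..<m}, parcs = {(i, j). i < m \<and> j < m \<and> i \<noteq> j} \<rparr>"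

definition disjoint_graph_union ::
  "'a pair_pre_digraph \<Rightarrow> 'b pair_pre_digraph \<Rightarrow> ('a + 'b) pair_pre_digraph" where
  "disjoint_graph_union G H =
     \<lparr> pverts = pverts G <+> pverts H,
       parcs = map_prod Inl Inl ` parcs G \<union> map_prod Inr Inr ` parcs H \<rparr>"

definition graph_join ::
  "'a pair_pre_digraph \<Rightarrow> 'b pair_pre_digraph \<Rightarrow> ('a + 'b) pair_pre_digraph" where
  "graph_join G H =
     \<lparr> pverts = pverts G <+> pverts H,
       parcs = map_prod Inl Inl ` parcs G \<union> map_prod Inr Inr ` parcs H
         \<union> (Inl ` pverts G) \<times> (Inr ` pverts H) \<union> (Inr ` pverts H) \<times> (Inl ` pverts G) \<rparr>"

definition graph_copies :: "nat \<Rightarrow> 'a pair_pre_digraph \<Rightarrow> (nat \<times> 'a) pair_pre_digraph" where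
  "graph_copies m G =
     \<lparr> pverts = {..<m} \<times> pverts G,
       parcs = {((i, u), (i, v)) | i u v. i < m \<and> (u, v) \<in> parcs G} \<rparr>"

text \<open>The graph \<open>F\<^bsub>p,q\<^esub> = K\<^sub>1 \<or> (pK\<^sub>1 \<union> qK\<^sub>2)\<close>; the friendship graph \<open>F\<^sub>n\<close> is \<open>F\<^bsub>0,n\<^esub>\<close>.\<close>

definition firefly :: "nat \<Rightarrow> nat \<Rightarrow> (nat + ((nat \<times> nat) + (nat \<times> nat))) pair_pre_digraph" where
  "firefly p q =
     graph_join (complete_graph 1)
       (disjoint_graph_union (graph_copies p (complete_graph 1)) (graph_copies q (complete_graph 2)))"

text \<open>
  With unit weights the library's \<open>\<mu>\<close> is the least length of a walk, which is infinite between
  vertices of different components; \<^const>\<open>real_of_ereal\<close> loses nothing when the graph is connected.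
\<close>

definition graph_dist :: "'a pair_pre_digraph \<Rightarrow> 'a \<Rightarrow> 'a \<Rightarrow> real" where
  "graph_dist G u v = real_of_ereal (wf_digraph.\<mu> (with_proj G) (\<lambda>_. 1) u v)"

definition transmission :: "'a pair_pre_digraph \<Rightarrow> 'a \<Rightarrow> real" where
  "transmission G v = (\<Sum>u\<in>pverts G. graph_dist G u v)"

text \<open>
  The library's matrices are indexed by \<open>{0..<N}\<close>, so the matrices of a graph depend on a list \<open>vs\<close>
  enumerating its vertices without repetition; different lists give permutation-similar matrices.
\<close>

definition distance_matrix :: "'a pair_pre_digraph \<Rightarrow> 'a list \<Rightarrow> real mat" where
  "distance_matrix G vs =
     mat (length vs) (length vs) (\<lambda>(i, j). graph_dist G (vs ! i) (vs ! j))"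

definition transmission_matrix :: "'a pair_pre_digraph \<Rightarrow> 'a list \<Rightarrow> real mat" where
  "transmission_matrix G vs =
     mat (length vs) (length vs) (\<lambda>(i, j). if i = j then transmission G (vs ! i) else 0)"

definition distance_signless_laplacian :: "'a pair_pre_digraph \<Rightarrow> 'a list \<Rightarrow> real mat" where
  "distance_signless_laplacian G vs = transmission_matrix G vs + distance_matrix G vs"

text \<open>
  Eigenvalues with algebraic multiplicity, taken in the complex numbers: the multiset has as many
  elements as the matrix has rows.
\<close>

definition eigenvalue_mset :: "real mat \<Rightarrow> complex multiset" where
  "eigenvalue_mset A = proots (char_poly (map_mat complex_of_real A))"

text \<open>
  The published formula for the constant term lacks the summand \<open>- 36 * n\<close>, without which the
  spectrum is wrong for every \<open>n \<ge> 1\<close>. The cubic is the characteristic polynomial of the quotient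
  matrix of the partition into centre, \<open>p\<close> pendant and \<open>2k\<close> triangle vertices (\<open>k = n - p\<close>,
  \<open>m = p + 2k\<close>), with rows \<open>(m, p, 2k)\<close>, \<open>(1, 2m + 2p - 3, 4k)\<close> and \<open>(1, 2p, 2m + 4k - 5)\<close>.
  For \<open>n = 2\<close>, \<open>p = 1\<close> the signless Laplacian has determinant \<open>132 = 3 * 44\<close>, and \<open>- 44\<close> is the
  constant term below, whereas the published one gives \<open>28\<close>.
\<close>

definition firefly_cubic :: "complex \<Rightarrow> complex \<Rightarrow> complex poly" where
  "firefly_cubic n p =
     [: - 64 * n^3 + 8 * p^3 + 96 * n^2 + 20 * p^2 + 96 * n^2 * p - 48 * n * p^2
          - 88 * n * p - 36 * n + 16 * p,
        56 * n^2 + 14 * p^2 - 62 * n + 27 * p - 56 * n * p + 15,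
        - (14 * n - 7 * p - 8),
        1 :]"

lemma pair_graph_complete_graph: "pair_graph (complete_graph m)"
proof
  have "{(i, j). i < m \<and> j < m \<and> i \<noteq> j} \<subseteq> {..<m} \<times> {..<m}" by auto
  then show "finite (parcs (complete_graph m))"
    unfolding complete_graph_def using finite_subset by fastforce
qed (auto simp: complete_graph_def symmetric_def sym_def)

lemma pair_graph_disjoint_graph_union:
  assumes "pair_graph G" "pair_graph H"
  shows "pair_graph (disjoint_graph_union G H)"
proof -
  interpret G: pair_graph G by fact
  interpret H: pair_graph H by fact
  have "sym (parcs G)" "sym (parcs H)"
    using G.pair_sym_arcs H.pair_sym_arcs by (auto simp: symmetric_def)
  then show ?thesis
    by unfold_locales
      (auto simp: disjoint_graph_union_def symmetric_def sym_def dest: G.wellformed' H.wellformed'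
        G.pair_no_loops H.pair_no_loops)
qed

lemma pair_graph_graph_join:
  assumes "pair_graph G" "pair_graph H"
  shows "pair_graph (graph_join G H)"
proof -
  interpret G: pair_graph G by fact
  interpret H: pair_graph H by fact
  have "sym (parcs G)" "sym (parcs H)"
    using G.pair_sym_arcs H.pair_sym_arcs by (auto simp: symmetric_def)
  then show ?thesis
    by unfold_locales
      (auto simp: graph_join_def symmetric_def sym_def dest: G.wellformed' H.wellformed'
        G.pair_no_loops H.pair_no_loops)
qed

lemma pair_graph_graph_copies:
  assumes "pair_graph G"
  shows "pair_graph (graph_copies m G)"
proof -
  interpret G: pair_graph G by fact
  have s: "sym (parcs G)"
    using G.pair_sym_arcs by (auto simp: symmetric_def)
  have "parcs (graph_copies m G) \<subseteq> ({..<m} \<times> pverts G) \<times> ({..<m} \<times> pverts G)"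
    by (auto simp: graph_copies_def dest: G.wellformed')
  then have "finite (parcs (graph_copies m G))"
    by (rule finite_subset) auto
  with s show ?thesis
    by unfold_locales
      (auto simp: graph_copies_def symmetric_def sym_def dest: G.wellformed' G.pair_no_loops)
qed

lemma pair_graph_firefly: "pair_graph (firefly p q)"
  unfolding firefly_def
  by (intro pair_graph_graph_join pair_graph_disjoint_graph_union pair_graph_graph_copies
      pair_graph_complete_graph)

lemma connected_firefly: "connected (with_proj (firefly p q))"
proof -
  interpret pair_graph "firefly p q" by (rule pair_graph_firefly)
  let ?G = "with_proj (firefly p q)"
  have c: "Inl 0 \<in> pverts (firefly p q)"
    by (auto simp: firefly_def graph_join_def complete_graph_def)
  have to_c: "v \<rightarrow>\<^sup>*\<^bsub>?G\<^esub> Inl 0 \<and> Inl 0 \<rightarrow>\<^sup>*\<^bsub>?G\<^esub> v" if "v \<in> pverts (firefly p q)" for v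
  proof (cases "v = Inl 0")
    case True
    with c show ?thesis by simp
  next
    case False
    with that have "(v, Inl 0) \<in> parcs (firefly p q)" "(Inl 0, v) \<in> parcs (firefly p q)"
      by (auto simp: firefly_def graph_join_def complete_graph_def)
    then show ?thesis by (auto intro!: reachable_adjI)
  qed
  have "strongly_connected ?G"
    using c to_c by (intro strongly_connectedI) (auto intro: reachable_trans)
  moreover have "mk_symmetric ?G = firefly p q"
    using pair_sym_arcs
    by (intro pair_pre_digraph.equality) (auto simp: mk_symmetric_def symmetric_def sym_def)
  ultimately show ?thesis
    by (simp add: connected_def)
qed

end

theory Submission
  imports Defs
begin

text \<open>
  Write \<open>k = n - p\<close> for the number of triangles and \<open>m = p + 2k\<close> for the number of vertices other
  than the centre. Two different ones of these are at distance 2 unless they belong to the same triangle, since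
  the centre is adjacent to both. So the transmission is \<open>m\<close> at the centre, \<open>2m - 1\<close> at a pendant
  vertex and \<open>2m - 2\<close> at a triangle vertex. Put \<open>y = x - (2m - 3)\<close>; then \<open>2m - 3 = 4n - 2p - 3\<close> is
  the root of \<open>y\<close> and \<open>4n - 2p - 5\<close> is the root of \<open>y + 2\<close>.

  In \<open>xI - D\<^sup>Q\<close> two vertices other than the centre have the entry \<open>-2\<close> unless they are equal or
  belong to the same triangle, and the row of the centre has \<open>-1\<close> in all these columns. Subtracting twice the row of
  the centre from each other row therefore leaves, outside the row and column of the centre, only
  a \<open>1 \<times> 1\<close> block \<open>y\<close> for each pendant vertex and a \<open>2 \<times> 2\<close> block with diagonal \<open>y + 1\<close> and
  off-diagonal \<open>1\<close> for each triangle. Such a \<open>2 \<times> 2\<close> block becomes triangular with diagonal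
  \<open>y + 2\<close>, \<open>y\<close> when the second column is added to the first and then the first row subtracted from
  the second. Finally the column of the centre is cleared below its top entry by adding multiples
  of the other columns. The multipliers have the denominators \<open>y\<close> and \<open>y + 2\<close>, so the column of the
  centre is first multiplied by \<open>y (y + 2)\<close>. The entry that remains in the corner is the cubic, whence
    \<open>y (y + 2) \<chi>(x) = cubic(x) y\<^bsup>p + k\<^esup> (y + 2)\<^sup>k\<close>
  for the characteristic polynomial \<open>\<chi>\<close> (\<open>firefly_char_poly\<close>). Comparing roots on both sides gives the
  theorem. As nothing is divided by \<open>y (y + 2)\<close>, the identity also covers \<open>p = n\<close>, where
  \<open>4n - 2p - 5\<close> occurs on the right as a root of the cubic only.

  The elimination is a single matrix identity (\<open>firefly_elimination\<close>): the matrix \<open>xI - D\<^sup>Q\<close> times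
  \<open>col_elim\<close> equals \<open>row_elim\<close> times \<open>eliminated\<close>, with triangular factors \<open>col_elim\<close>, \<open>row_elim\<close>
  and \<open>eliminated\<close> for a suitable order of the vertices.
\<close>

section \<open>Matrices indexed by the elements of lists\<close>

text \<open>
  Allowing different lists for rows and columns makes permutation matrices instances: they are
  the matrices of the Kronecker delta for two enumerations of one set.
\<close>
definition indexed_mat :: "('a \<Rightarrow> 'b \<Rightarrow> 'c) \<Rightarrow> 'a list \<Rightarrow> 'b list \<Rightarrow> 'c mat" where
  "indexed_mat f us vs = mat (length us) (length vs) (\<lambda>(i, j). f (us ! i) (vs ! j))"

lemma indexed_mat_carrier [simp]:
  "indexed_mat f us vs \<in> carrier_mat (length us) (length vs)"
  by (simp add: indexed_mat_def)

lemma indexed_mat_cong: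
  assumes "\<And>u v. u \<in> set us \<Longrightarrow> v \<in> set vs \<Longrightarrow> f u v = g u v"
  shows "indexed_mat f us vs = indexed_mat g us vs"
  using assms by (auto simp: indexed_mat_def intro!: eq_matI)

text \<open>
  The product is computed by a sum over the set of vertices, so that identities between matrices
  can be checked on entries, without reference to the order of the vertices.
\<close>
lemma indexed_mat_mult:
  fixes f :: "'a \<Rightarrow> 'b \<Rightarrow> 'd::comm_semiring_1"
  assumes "distinct vs"
  shows "indexed_mat f us vs * indexed_mat g vs ws =
    indexed_mat (\<lambda>u w. \<Sum>v\<in>set vs. f u v * g v w) us ws"
proof (rule eq_matI)
  fix i j
  assume ij: "i < dim_row (indexed_mat (\<lambda>u w. \<Sum>v\<in>set vs. f u v * g v w) us ws)"
    "j < dim_col (indexed_mat (\<lambda>u w. \<Sum>v\<in>set vs. f u v * g v w) us ws)"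
  have "(\<Sum>l = 0..<length vs. f (us ! i) (vs ! l) * g (vs ! l) (ws ! j)) =
    (\<Sum>v\<in>set vs. f (us ! i) v * g v (ws ! j))"
    using sum.reindex_bij_betw[OF bij_betw_nth[OF assms refl refl], where g = "\<lambda>v. f (us ! i) v * g v (ws ! j)"]
    by (simp add: atLeast0LessThan)
  with ij show "(indexed_mat f us vs * indexed_mat g vs ws) $$ (i, j) =
    indexed_mat (\<lambda>u w. \<Sum>v\<in>set vs. f u v * g v w) us ws $$ (i, j)"
    by (simp add: indexed_mat_def scalar_prod_def)
qed (simp_all add: indexed_mat_def)

lemma indexed_mat_delta_mult:
  fixes f :: "'a \<Rightarrow> 'b \<Rightarrow> 'd::comm_semiring_1"
  assumes "distinct ws" "set us \<subseteq> set ws"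
  shows "indexed_mat (\<lambda>u v. of_bool (u = v)) us ws * indexed_mat f ws vs = indexed_mat f us vs"
  unfolding indexed_mat_mult[OF assms(1)]
  using assms(2) by (intro indexed_mat_cong)
    (simp add: of_bool_def if_distrib[of "\<lambda>x. x * _"] sum.delta cong: if_cong, blast)

lemma indexed_mat_mult_delta:
  fixes f :: "'a \<Rightarrow> 'b \<Rightarrow> 'd::comm_semiring_1"
  assumes "distinct ws" "set us \<subseteq> set ws"
  shows "indexed_mat f vs ws * indexed_mat (\<lambda>u v. of_bool (u = v)) ws us = indexed_mat f vs us"
  unfolding indexed_mat_mult[OF assms(1)]
  using assms(2) by (intro indexed_mat_cong)
    (simp add: of_bool_def if_distrib[of "\<lambda>x. _ * x"] sum.delta cong: if_cong, blast)

text \<open>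
  The Kronecker deltas for \<open>vs, ws\<close> and for \<open>ws, vs\<close> are inverse to each other and conjugate one
  matrix into the other. The characteristic polynomial may thus be computed for any convenient
  order of the vertices.
\<close>
lemma det_indexed_mat_reorder:
  fixes f :: "'a \<Rightarrow> 'a \<Rightarrow> 'd::comm_ring_1"
  assumes "distinct vs" "distinct ws" "set vs = set ws"
  shows "det (indexed_mat f vs vs) = det (indexed_mat f ws ws)"
proof -
  let ?P = "indexed_mat (\<lambda>u v. of_bool (u = v) :: 'd)"
  have len: "length vs = length ws"
    using assms by (metis distinct_card)
  have car: "indexed_mat g us us' \<in> carrier_mat (length ws) (length ws)"
    if "us \<in> {vs, ws}" "us' \<in> {vs, ws}" for g :: "'a \<Rightarrow> 'a \<Rightarrow> 'd" and us us'
    using that len by (auto simp: indexed_mat_def)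
  have "det (indexed_mat f vs vs) = det (?P vs ws * indexed_mat f ws ws * ?P ws vs)"
    using assms by (simp add: indexed_mat_delta_mult indexed_mat_mult_delta)
  also have "\<dots> = det (?P vs ws) * det (indexed_mat f ws ws) * det (?P ws vs)"
    by (simp add: det_mult[where n = "length ws"] car mult_carrier_mat[where n = "length ws"])
  also have "\<dots> = det (?P vs ws * ?P ws vs) * det (indexed_mat f ws ws)"
    by (simp add: det_mult[where n = "length ws"] car)
  also have "?P vs ws * ?P ws vs = 1\<^sub>m (length vs)"
    using assms by (simp add: indexed_mat_delta_mult)
      (auto simp: indexed_mat_def nth_eq_iff_index_eq intro!: eq_matI)
  finally show ?thesis by simp
qed

lemma det_indexed_mat_upper_triangular:
  fixes f :: "'a \<Rightarrow> 'a \<Rightarrow> 'd::comm_ring_1"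
  assumes "distinct vs" "sorted_wrt (\<lambda>u v. f v u = 0) vs"
  shows "det (indexed_mat f vs vs) = (\<Prod>v\<in>set vs. f v v)"
proof -
  have "upper_triangular (indexed_mat f vs vs)"
    using assms(2) by (auto simp: upper_triangular_def indexed_mat_def sorted_wrt_iff_nth_less)
  then have "det (indexed_mat f vs vs) = prod_list (diag_mat (indexed_mat f vs vs))"
    by (rule det_upper_triangular[OF _ indexed_mat_carrier])
  also have "diag_mat (indexed_mat f vs vs) = map (\<lambda>v. f v v) vs"
    by (rule nth_equalityI) (auto simp: diag_mat_def indexed_mat_def)
  finally show ?thesis
    using assms(1) by (simp add: prod.distinct_set_conv_list)
qed

lemma det_indexed_mat_lower_triangular:
  fixes f :: "'a \<Rightarrow> 'a \<Rightarrow> 'd::comm_ring_1"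
  assumes "distinct vs" "sorted_wrt (\<lambda>u v. f u v = 0) vs"
  shows "det (indexed_mat f vs vs) = (\<Prod>v\<in>set vs. f v v)"
proof -
  have "indexed_mat f vs vs = transpose_mat (indexed_mat (\<lambda>u v. f v u) vs vs)"
    by (auto simp: indexed_mat_def)
  then have "det (indexed_mat f vs vs) = det (indexed_mat (\<lambda>u v. f v u) vs vs)"
    by (metis det_transpose indexed_mat_carrier)
  with assms show ?thesis
    by (simp add: det_indexed_mat_upper_triangular)
qed

lemma poly_char_poly_indexed_mat:
  fixes f :: "'a \<Rightarrow> 'a \<Rightarrow> 'd::field"
  assumes "distinct vs"
  shows "poly (char_poly (indexed_mat f vs vs)) x =
    det (indexed_mat (\<lambda>u v. of_bool (u = v) * x - f u v) vs vs)"
  unfolding char_poly_def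
  by (rule poly_det_cong[of _ "length vs"])
    (use assms in \<open>auto simp: char_poly_matrix_def indexed_mat_def nth_eq_iff_index_eq\<close>)

section \<open>Distances and transmissions in the firefly graph\<close>

lemma (in pair_wf_digraph) graph_dist_eqI:
  assumes "awalk u w v" "length w = d"
    and "\<And>w'. awalk u w' v \<Longrightarrow> d \<le> length w'"
  shows "graph_dist G u v = real d"
proof -
  have cost: "awalk_cost (\<lambda>_. 1) w' = real (length w')" for w' :: "('a \<times> 'a) list"
    by (induction w') auto
  have "\<mu> (\<lambda>_. 1) u v = ereal (real d)"
    unfolding \<mu>_def cost using assms by (auto intro!: antisym INF_lower2[of w] INF_greatest)
  then show ?thesis
    by (simp add: graph_dist_def)
qed

lemma (in pair_wf_digraph) graph_dist_self:
  "u \<in> pverts G \<Longrightarrow> graph_dist G u u = 0"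
  using graph_dist_eqI[of u "[]" u 0] by (simp add: awalk_Nil_iff)

lemma (in pair_wf_digraph) graph_dist_adjacent:
  assumes "(u, v) \<in> parcs G" "u \<noteq> v"
  shows "graph_dist G u v = 1"
proof -
  have "awalk u [(u, v)] v"
    using assms(1) by (auto simp: awalk_Cons_iff awalk_Nil_iff dest: wellformed')
  moreover have "1 \<le> length w" if "awalk u w v" for w
    using that assms(2) by (cases w) (auto simp: awalk_Nil_iff)
  ultimately show ?thesis
    using graph_dist_eqI[of u "[(u, v)]" v 1] by simp
qed

lemma (in pair_wf_digraph) graph_dist_common_neighbour:
  assumes "(u, c) \<in> parcs G" "(c, v) \<in> parcs G" "(u, v) \<notin> parcs G" "u \<noteq> v"
  shows "graph_dist G u v = 2"
proof -
  have "awalk u [(u, c), (c, v)] v"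
    using assms(1,2) by (auto simp: awalk_Cons_iff awalk_Nil_iff dest: wellformed')
  moreover have "2 \<le> length w" if "awalk u w v" for w
  proof (rule ccontr)
    assume "\<not> 2 \<le> length w"
    then consider "w = []" | e where "w = [e]"
      by (cases w; cases "tl w") auto
    then show False
      using that assms(3,4) by cases (auto simp: awalk_Cons_iff awalk_Nil_iff)
  qed
  ultimately show ?thesis
    using graph_dist_eqI[of u "[(u, c), (c, v)]" v 2] by simp
qed

text \<open>
  The centre is \<open>Inl 0\<close>, the pendant vertices are \<open>Inr (Inl (i, 0))\<close>, and \<open>Inr (Inr (i, 0))\<close>,
  \<open>Inr (Inr (i, 1))\<close> are the two remaining vertices of the \<open>i\<close>-th triangle.
\<close>
lemma pverts_firefly:
  "pverts (firefly p k) = {0} <+> ({..<p} \<times> {0} <+> {..<k} \<times> {0, 1})"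
  by (auto simp: firefly_def graph_join_def disjoint_graph_union_def graph_copies_def complete_graph_def)

lemma firefly_vertex_cases:
  assumes "v \<in> pverts (firefly p k)"
  obtains "v = Inl 0" | i where "i < p" "v = Inr (Inl (i, 0))"
    | i where "i < k" "v = Inr (Inr (i, 0))" | i where "i < k" "v = Inr (Inr (i, 1))"
  using assms by (auto simp: pverts_firefly)

lemma sum_pverts_firefly:
  "(\<Sum>v\<in>pverts (firefly p k). f v) = f (Inl 0) + ((\<Sum>i<p. f (Inr (Inl (i, 0)))) +
     (\<Sum>i<k. f (Inr (Inr (i, 0))) + f (Inr (Inr (i, 1)))))"
  by (simp add: pverts_firefly sum.Plus sum.cartesian_product')

lemma prod_pverts_firefly:
  "(\<Prod>v\<in>pverts (firefly p k). f v) = f (Inl 0) * ((\<Prod>i<p. f (Inr (Inl (i, 0)))) *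
     (\<Prod>i<k. f (Inr (Inr (i, 0))) * f (Inr (Inr (i, 1)))))"
  by (simp add: pverts_firefly prod.Plus prod.cartesian_product')

type_synonym firefly_vertex = "nat + (nat \<times> nat + nat \<times> nat)"

fun firefly_dist :: "firefly_vertex \<Rightarrow> firefly_vertex \<Rightarrow> real" where
  "firefly_dist (Inl _) (Inl _) = 0"
| "firefly_dist (Inl _) (Inr _) = 1"
| "firefly_dist (Inr _) (Inl _) = 1"
| "firefly_dist (Inr (Inl (i, _))) (Inr (Inl (j, _))) = (if i = j then 0 else 2)"
| "firefly_dist (Inr (Inr (i, s))) (Inr (Inr (j, t))) =
     (if i = j then if s = t then 0 else 1 else 2)"
| "firefly_dist (Inr _) (Inr _) = 2"

lemma firefly_adjacent_iff:
  assumes "u \<in> pverts (firefly p k)" "v \<in> pverts (firefly p k)"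
  shows "(u, v) \<in> parcs (firefly p k) \<longleftrightarrow> firefly_dist u v = 1"
proof -
  \<comment> \<open>The arcs are nested images under \<open>map_prod\<close>, in which the simplifier does not decide membership.\<close>
  have map_prod_iff:
    "(Inr a, Inr b) \<in> map_prod Inr Inr ` A \<longleftrightarrow> (a, b) \<in> A"
    "(Inl c, Inl d) \<in> map_prod Inl Inl ` B \<longleftrightarrow> (c, d) \<in> B"
    "(x, Inl d) \<notin> map_prod Inr Inr ` A" "(Inl c, x) \<notin> map_prod Inr Inr ` A"
    "(x', Inr b) \<notin> map_prod Inl Inl ` B" "(Inr a, x') \<notin> map_prod Inl Inl ` B"
    for a b :: 'a and c d :: 'b and x :: "'b + 'a" and x' :: "'b + 'a" and A B
    by force+
  show ?thesis
    by (rule firefly_vertex_cases[OF assms(1)]; rule firefly_vertex_cases[OF assms(2)])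
      (auto simp: firefly_def graph_join_def disjoint_graph_union_def graph_copies_def
        complete_graph_def map_prod_iff)
qed

text \<open>
  Two different vertices that are not adjacent are both different from the centre, which is then a
  common neighbour.
\<close>
lemma graph_dist_firefly:
  assumes "u \<in> pverts (firefly p k)" "v \<in> pverts (firefly p k)"
  shows "graph_dist (firefly p k) u v = firefly_dist u v"
proof -
  interpret pair_graph "firefly p k" by (rule pair_graph_firefly)
  have centre: "Inl 0 \<in> pverts (firefly p k)"
    by (auto simp: pverts_firefly)
  have "u = v \<or> firefly_dist u v = 1 \<or>
      firefly_dist u v = 2 \<and> firefly_dist u (Inl 0) = 1 \<and> firefly_dist (Inl 0) v = 1"
    by (rule firefly_vertex_cases[OF assms(1)]; rule firefly_vertex_cases[OF assms(2)]) auto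
  then consider "u = v" | "u \<noteq> v" "firefly_dist u v = 1"
    | "u \<noteq> v" "firefly_dist u v = 2" "firefly_dist u (Inl 0) = 1" "firefly_dist (Inl 0) v = 1"
    by blast
  then show ?thesis
  proof cases
    case 1
    with assms show ?thesis
      by (auto simp: graph_dist_self elim: firefly_vertex_cases)
  next
    case 2
    with assms show ?thesis
      by (simp add: graph_dist_adjacent firefly_adjacent_iff)
  next
    case 3
    with assms centre show ?thesis
      using graph_dist_common_neighbour[of u "Inl 0" v] by (simp add: firefly_adjacent_iff)
  qed
qed

text \<open>
  Here \<open>m\<close> is the number of vertices other than the centre: a pendant vertex has distance 2 to
  \<open>m - 1\<close> of them, a triangle vertex to \<open>m - 2\<close> of them.
\<close>
fun firefly_transmission :: "nat \<Rightarrow> firefly_vertex \<Rightarrow> real" where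
  "firefly_transmission m (Inl _) = real m"
| "firefly_transmission m (Inr (Inl _)) = 2 * real m - 1"
| "firefly_transmission m (Inr (Inr _)) = 2 * real m - 2"

lemma sum_if_eq:
  fixes a b :: "'a::comm_ring_1"
  assumes "i < m"
  shows "(\<Sum>j<m. if i = j then a else b) = of_nat m * b + (a - b)"
    and "(\<Sum>j<m. if j = i then a else b) = of_nat m * b + (a - b)"
proof -
  have "(\<Sum>j<m. if i = j then a else b) = (\<Sum>j<m. b + (if i = j then a - b else 0))"
    by (rule sum.cong) auto
  with assms show "(\<Sum>j<m. if i = j then a else b) = of_nat m * b + (a - b)"
    by (simp add: sum.distrib)
  then show "(\<Sum>j<m. if j = i then a else b) = of_nat m * b + (a - b)"
    by (simp add: eq_commute)
qed

lemma transmission_firefly: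
  assumes "v \<in> pverts (firefly p k)"
  shows "transmission (firefly p k) v = firefly_transmission (p + 2 * k) v"
proof -
  have "transmission (firefly p k) v = (\<Sum>u\<in>pverts (firefly p k). firefly_dist u v)"
    using assms by (simp add: transmission_def graph_dist_firefly)
  then show ?thesis
    using assms
    by (elim firefly_vertex_cases) (simp_all add: sum_pverts_firefly sum.distrib sum_if_eq)
qed

section \<open>Elimination in the characteristic matrix\<close>

text \<open>
  The entries of \<open>xI - D\<^sup>Q\<close> at \<open>x = y + 2m - 3\<close>. With this shift the blocks that remain after the
  elimination of the row of the centre depend on \<open>y\<close> alone.
\<close>
fun firefly_char_entry :: "nat \<Rightarrow> complex \<Rightarrow> firefly_vertex \<Rightarrow> firefly_vertex \<Rightarrow> complex" where
  "firefly_char_entry m y (Inl _) (Inl _) = y + of_nat m - 3"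
| "firefly_char_entry m y (Inl _) (Inr _) = - 1"
| "firefly_char_entry m y (Inr _) (Inl _) = - 1"
| "firefly_char_entry m y (Inr (Inl (i, _))) (Inr (Inl (j, _))) = (if i = j then y - 2 else - 2)"
| "firefly_char_entry m y (Inr (Inr (i, s))) (Inr (Inr (j, t))) =
     (if i = j then if s = t then y - 1 else - 1 else - 2)"
| "firefly_char_entry m y (Inr _) (Inr _) = - 2"

lemma poly_char_poly_firefly:
  assumes "distinct vs" "set vs = pverts (firefly p k)"
  shows "poly (char_poly (map_mat complex_of_real (distance_signless_laplacian (firefly p k) vs)))
      (y + 2 * of_nat (p + 2 * k) - 3) =
    det (indexed_mat (firefly_char_entry (p + 2 * k) y) vs vs)"
proof -
  let ?M = "\<lambda>u v. complex_of_real
    ((if u = v then transmission (firefly p k) u else 0) + graph_dist (firefly p k) u v)"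
  have "map_mat complex_of_real (distance_signless_laplacian (firefly p k) vs) =
      indexed_mat ?M vs vs"
    using assms(1) by (auto simp: distance_signless_laplacian_def transmission_matrix_def
      distance_matrix_def indexed_mat_def nth_eq_iff_index_eq)
  moreover have "of_bool (u = v) * (y + 2 * of_nat (p + 2 * k) - 3) - ?M u v =
      firefly_char_entry (p + 2 * k) y u v"
    if "u \<in> pverts (firefly p k)" "v \<in> pverts (firefly p k)" for u v
    unfolding transmission_firefly[OF that(1)] graph_dist_firefly[OF that]
    by (rule firefly_vertex_cases[OF that(1)]; rule firefly_vertex_cases[OF that(2)]) auto
  ultimately show ?thesis
    using assms by (auto simp: poly_char_poly_indexed_mat intro!: arg_cong[where f = det] indexed_mat_cong)
qed

text \<open>
  The inverse of the row operations. Multiplication by \<open>row_elim\<close> from the left adds, in each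
  triangle, the row of the first vertex to that of the second, and after that twice the row of
  the centre to every other row.
\<close>
fun row_elim :: "firefly_vertex \<Rightarrow> firefly_vertex \<Rightarrow> complex" where
  "row_elim (Inl _) (Inl _) = 1"
| "row_elim (Inr _) (Inl _) = 2"
| "row_elim (Inr (Inl (i, _))) (Inr (Inl (j, _))) = of_bool (i = j)"
| "row_elim (Inr (Inr (i, s))) (Inr (Inr (j, t))) = of_bool (i = j) * of_bool (t \<le> s)"
| "row_elim _ _ = 0"

text \<open>
  After twice the row of the centre is subtracted, the column of the centre has the entry
  \<open>-1 - 2 (y + m - 3) = - (2 y + 2 m - 5)\<close> in every other row. The all-ones vector on the pendant
  vertices is an eigenvector of the remaining block for \<open>y\<close>, the one on the triangle vertices for
  \<open>y + 2\<close>. So, once the column of the centre is multiplied by \<open>y (y + 2)\<close>, adding the column of each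
  pendant vertex \<open>(2 y + 2 m - 5) (y + 2)\<close> times and that of each triangle vertex
  \<open>(2 y + 2 m - 5) y\<close> times clears it below the corner. On the other columns the matrix adds, in
  each triangle, the column of the second vertex to that of the first, which is what \<open>row_elim\<close>
  does there.
\<close>
fun col_elim :: "nat \<Rightarrow> complex \<Rightarrow> firefly_vertex \<Rightarrow> firefly_vertex \<Rightarrow> complex" where
  "col_elim m y (Inl _) (Inl _) = y * (y + 2)"
| "col_elim m y (Inr (Inl _)) (Inl _) = (2 * y + 2 * of_nat m - 5) * (y + 2)"
| "col_elim m y (Inr (Inr _)) (Inl _) = (2 * y + 2 * of_nat m - 5) * y"
| "col_elim m y u v = row_elim u v"

text \<open>
  The entry at the centre after the column operations: \<open>y (y + 2)\<close> times the original one, minus the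
  sum of the multipliers of all other columns, whose entries in the row of the centre are \<open>-1\<close>.
\<close>
definition firefly_corner :: "nat \<Rightarrow> nat \<Rightarrow> complex \<Rightarrow> complex" where
  "firefly_corner p k y =
     (y + of_nat (p + 2 * k) - 3) * y * (y + 2) -
     (2 * y + 2 * of_nat (p + 2 * k) - 5) * (of_nat p * (y + 2) + 2 * of_nat k * y)"

text \<open>
  The triangular form. The entry \<open>-2\<close> in the row of the centre belongs to the first vertex of a
  triangle, whose column has received that of the second vertex.
\<close>
fun eliminated :: "nat \<Rightarrow> nat \<Rightarrow> complex \<Rightarrow> firefly_vertex \<Rightarrow> firefly_vertex \<Rightarrow> complex" where
  "eliminated p k y (Inl _) (Inl _) = firefly_corner p k y"
| "eliminated p k y (Inl _) (Inr (Inl _)) = - 1"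
| "eliminated p k y (Inl _) (Inr (Inr (_, t))) = (if t = 0 then - 2 else - 1)"
| "eliminated p k y (Inr (Inl (i, _))) (Inr (Inl (j, _))) = of_bool (i = j) * y"
| "eliminated p k y (Inr (Inr (i, s))) (Inr (Inr (j, t))) = of_bool (i = j) *
     (if s = t then if s = 0 then y + 2 else y else of_bool (s < t))"
| "eliminated p k y _ _ = 0"

lemma sum_of_bool_eq_mult:
  fixes g :: "'a \<Rightarrow> 'b::semiring_1"
  assumes "finite A" "a \<in> A"
  shows "(\<Sum>i\<in>A. of_bool (a = i) * g i) = g a" "(\<Sum>i\<in>A. g i * of_bool (i = a)) = g a"
  using assms by (simp_all add: of_bool_def if_distrib[of "\<lambda>z. z * _"] if_distrib[of "\<lambda>z. _ * z"] cong: if_cong)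

lemma row_elim_mult:
  assumes "u \<in> pverts (firefly p k)"
  shows "(\<Sum>w\<in>pverts (firefly p k). row_elim u w * g w) =
    (case u of Inl _ \<Rightarrow> g u
     | Inr (Inl _) \<Rightarrow> 2 * g (Inl 0) + g u
     | Inr (Inr (i, s)) \<Rightarrow> 2 * g (Inl 0) + g (Inr (Inr (i, 0))) + (if s = 0 then 0 else g u))"
  using assms by (elim firefly_vertex_cases)
    (simp_all add: sum_pverts_firefly sum_of_bool_eq_mult sum.distrib mult.assoc)

lemma mult_col_elim:
  assumes "v \<in> pverts (firefly p k)" "v \<noteq> Inl 0"
  shows "(\<Sum>w\<in>pverts (firefly p k). g w * col_elim m y w v) =
    (case v of Inl _ \<Rightarrow> 0
     | Inr (Inl _) \<Rightarrow> g v
     | Inr (Inr (i, t)) \<Rightarrow> g v + (if t = 0 then g (Inr (Inr (i, 1))) else 0))"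
  using assms by (elim firefly_vertex_cases)
    (simp_all add: sum_pverts_firefly sum_of_bool_eq_mult sum.distrib)

lemma firefly_elimination:
  fixes y :: complex
  assumes "u \<in> pverts (firefly p k)" "v \<in> pverts (firefly p k)"
  shows "(\<Sum>w\<in>pverts (firefly p k).
      firefly_char_entry (p + 2 * k) y u w * col_elim (p + 2 * k) y w v) =
    (\<Sum>w\<in>pverts (firefly p k). row_elim u w * eliminated p k y w v)"
proof (cases "v = Inl 0")
  case True
  show ?thesis
    unfolding row_elim_mult[OF assms(1)] True
    by (rule firefly_vertex_cases[OF assms(1)])
      (simp_all add: sum_pverts_firefly firefly_corner_def sum.distrib sum_if_eq
        flip: sum_distrib_right, simp_all add: algebra_simps)
next
  case False
  show ?thesis
    unfolding row_elim_mult[OF assms(1)] mult_col_elim[OF assms(2) False]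
    by (rule firefly_vertex_cases[OF assms(1)]; rule firefly_vertex_cases[OF assms(2)])
      (use False in auto)
qed

text \<open>
  Taking determinants in the elimination identity: \<open>col_elim\<close> contributes \<open>y (y + 2)\<close> on the left
  and \<open>row_elim\<close> contributes \<open>1\<close> on the right.
\<close>
lemma det_firefly_char:
  assumes "distinct vs" "set vs = pverts (firefly p k)"
  shows "y * (y + 2) * det (indexed_mat (firefly_char_entry (p + 2 * k) y) vs vs) =
    firefly_corner p k y * y ^ (p + k) * (y + 2) ^ k"
proof -
  \<comment> \<open>All three factors are triangular once the centre comes first and, in every triangle, the
    vertex labelled 0 comes before the one labelled 1.\<close>
  define ws :: "firefly_vertex list" where
    "ws = Inl 0 # map (\<lambda>i. Inr (Inl (i, 0))) [0..<p] @
       map (\<lambda>i. Inr (Inr (i, 0))) [0..<k] @ map (\<lambda>i. Inr (Inr (i, 1))) [0..<k]"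
  have set_ws: "set ws = pverts (firefly p k)"
    by (auto simp: ws_def pverts_firefly)
  have dist_ws: "distinct ws"
    by (auto simp: ws_def distinct_map inj_on_def)
  have upt_neq: "sorted_wrt (\<lambda>i j. i \<noteq> j) [0..<l]"
    "sorted_wrt (\<lambda>i j. j = i \<longrightarrow> P) [0..<l]" for l :: nat and P
    by (rule sorted_wrt_mono_rel[OF _ sorted_wrt_upt], simp)+
  note order = ws_def sorted_wrt_append sorted_wrt_map upt_neq
  let ?c = "\<lambda>f. indexed_mat f ws ws"
  have "?c (firefly_char_entry (p + 2 * k) y) * ?c (col_elim (p + 2 * k) y) =
      ?c row_elim * ?c (eliminated p k y)"
    unfolding indexed_mat_mult[OF dist_ws] set_ws
    by (rule indexed_mat_cong) (simp add: set_ws firefly_elimination)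
  then have "det (?c (firefly_char_entry (p + 2 * k) y)) * det (?c (col_elim (p + 2 * k) y)) =
      det (?c row_elim) * det (?c (eliminated p k y))"
    by (metis det_mult indexed_mat_carrier)
  moreover have "det (?c (col_elim (p + 2 * k) y)) = y * (y + 2)"
  proof -
    have "sorted_wrt (\<lambda>u v. col_elim (p + 2 * k) y u v = 0) ws"
      by (auto simp: order)
    then show ?thesis
      by (simp add: det_indexed_mat_lower_triangular dist_ws set_ws prod_pverts_firefly)
  qed
  moreover have "det (?c row_elim) = 1"
  proof -
    have "sorted_wrt (\<lambda>u v. row_elim u v = 0) ws"
      by (auto simp: order)
    then show ?thesis
      by (simp add: det_indexed_mat_lower_triangular dist_ws set_ws prod_pverts_firefly)
  qed
  moreover have "det (?c (eliminated p k y)) = firefly_corner p k y * (y ^ p * ((y + 2) * y) ^ k)"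
  proof -
    have "sorted_wrt (\<lambda>u v. eliminated p k y v u = 0) ws"
      by (auto simp: order)
    then show ?thesis
      by (simp add: det_indexed_mat_upper_triangular dist_ws set_ws prod_pverts_firefly)
  qed
  ultimately show ?thesis
    unfolding det_indexed_mat_reorder[OF assms(1) dist_ws assms(2)[folded set_ws]]
    by (simp add: power_add power_mult_distrib mult_ac)
qed

section \<open>The spectrum\<close>

lemma firefly_corner_eq_cubic:
  "firefly_corner p k y = poly (firefly_cubic (of_nat (p + k)) (of_nat p)) (y + 2 * of_nat (p + 2 * k) - 3)"
  by (simp add: firefly_corner_def firefly_cubic_def power2_eq_square power3_eq_cube algebra_simps)

text \<open>
  The determinant identity holds at every point, including the zeros of \<open>y (y + 2)\<close>, and so is an
  identity of polynomials.
\<close>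
lemma firefly_char_poly:
  assumes "distinct vs" "set vs = pverts (firefly p k)"
  defines "a \<equiv> 2 * of_nat (p + 2 * k) - 3" and "b \<equiv> 2 * of_nat (p + 2 * k) - 5"
  shows "[:- a, 1:] * [:- b, 1:] *
      char_poly (map_mat complex_of_real (distance_signless_laplacian (firefly p k) vs)) =
    firefly_cubic (of_nat (p + k)) (of_nat p) * [:- a, 1:] ^ (p + k) * [:- b, 1:] ^ k"
proof (rule poly_ext)
  fix x
  define y where "y = x - a"
  have x: "x = y + 2 * of_nat (p + 2 * k) - 3"
    and factors: "poly [:- a, 1:] x = y" "poly [:- b, 1:] x = y + 2"
    by (simp_all add: y_def a_def b_def)
  show "poly ([:- a, 1:] * [:- b, 1:] *
      char_poly (map_mat complex_of_real (distance_signless_laplacian (firefly p k) vs))) x =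
    poly (firefly_cubic (of_nat (p + k)) (of_nat p) * [:- a, 1:] ^ (p + k) * [:- b, 1:] ^ k) x"
    unfolding poly_mult poly_power factors
    using det_firefly_char[OF assms(1,2), of y] poly_char_poly_firefly[OF assms(1,2), of y, folded x]
      firefly_corner_eq_cubic[of p k y, folded x]
    by simp
qed

theorem corollary4p4:
  fixes n p :: nat
    and vs :: "(nat + ((nat \<times> nat) + (nat \<times> nat))) list"
  assumes "1 \<le> p" and "p \<le> n"
    and "distinct vs" and "set vs = pverts (firefly p (n - p))"
  shows "\<exists>l1 l2 l3 :: complex.
    proots (firefly_cubic (of_nat n) (of_nat p)) = {#l1, l2, l3#} \<and>
    (p < n \<longrightarrow>
      eigenvalue_mset (distance_signless_laplacian (firefly p (n - p)) vs) =
        replicate_mset (n - 1) (4 * of_nat n - 2 * of_nat p - 3) +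
        replicate_mset (n - p - 1) (4 * of_nat n - 2 * of_nat p - 5) +
        {#l1, l2, l3#}) \<and>
    (p = n \<longrightarrow>
      eigenvalue_mset (distance_signless_laplacian (firefly p (n - p)) vs) +
        {#4 * of_nat n - 2 * of_nat p - 5#} =
        replicate_mset (n - 1) (4 * of_nat n - 2 * of_nat p - 3) +
        {#l1, l2, l3#})"
proof -
  define a b :: complex where
    "a = 4 * of_nat n - 2 * of_nat p - 3" and "b = 4 * of_nat n - 2 * of_nat p - 5"
  let ?Q = "distance_signless_laplacian (firefly p (n - p)) vs"
  let ?cubic = "firefly_cubic (of_nat n) (of_nat p)"
  let ?chi = "char_poly (map_mat complex_of_real ?Q)"
  have "?Q \<in> carrier_mat (length vs) (length vs)"
    by (simp add: distance_signless_laplacian_def distance_matrix_def)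
  then have "?chi \<noteq> 0"
    using degree_monic_char_poly[of "map_mat complex_of_real ?Q" "length vs"] by auto
  have "?cubic \<noteq> 0" and deg: "degree ?cubic = 3"
    by (simp_all add: firefly_cubic_def)
  obtain ls where ls: "mset ls = proots ?cubic"
    by (metis ex_mset)
  then have "length ls = 3"
    by (metis size_mset size_proots_complex deg)
  then obtain l1 l2 l3 where "ls = [l1, l2, l3]"
    by (auto simp: numeral_3_eq_3 length_Suc_conv)
  with ls have roots: "proots ?cubic = {#l1, l2, l3#}"
    by simp
  have "[:- a, 1:] * [:- b, 1:] * ?chi = ?cubic * [:- a, 1:] ^ n * [:- b, 1:] ^ (n - p)"
    using firefly_char_poly[OF assms(3,4)] \<open>p \<le> n\<close>
    by (simp add: a_def b_def of_nat_diff algebra_simps)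
  moreover have "proots ([:- a, 1:] * [:- b, 1:] * ?chi) = {#a, b#} + eigenvalue_mset ?Q"
  proof -
    have "proots ([:- a, 1:] * [:- b, 1:]) = {#a, b#}"
      by (subst proots_mult) auto
    then show ?thesis
      using \<open>?chi \<noteq> 0\<close> unfolding eigenvalue_mset_def
      by (subst proots_mult) (auto simp del: mult_pCons_left mult_pCons_right)
  qed
  moreover have "proots (?cubic * [:- a, 1:] ^ n * [:- b, 1:] ^ (n - p)) =
      {#l1, l2, l3#} + replicate_mset n a + replicate_mset (n - p) b"
    using \<open>?cubic \<noteq> 0\<close> by (simp add: proots_mult proots_power roots)
  ultimately have "add_mset a (add_mset b (eigenvalue_mset ?Q)) =
      {#l1, l2, l3#} + replicate_mset n a + replicate_mset (n - p) b"
    by simp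
  \<comment> \<open>Since \<open>n \<ge> 1\<close>, the element \<open>a\<close> cancels; \<open>b\<close> cancels if \<open>p < n\<close>. If \<open>p = n\<close>, it stays on
    the left, where the claim has it.\<close>
  moreover have "replicate_mset n a = add_mset a (replicate_mset (n - 1) a)"
    using assms(1,2) by (cases n) auto
  moreover have "replicate_mset (n - p) b = add_mset b (replicate_mset (n - p - 1) b)" if "p < n"
    using that by (cases "n - p") auto
  ultimately show ?thesis
    using roots unfolding a_def[symmetric] b_def[symmetric]
    by (intro exI[of _ l1] exI[of _ l2] exI[of _ l3]) auto
qed

end
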